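(* Let $\mathbb{B}$ be a real separable Banach space, $F:\mathbb{B}\to\mathbb{B}$ a contraction with constant $c\in[0,1)$ and unique fixed point $x^*$, let $0<a<1$, let $(\xi_n)_{n\ge 1}$ be independent zero-mean $\mathbb{B}$-valued random variables with $\sup_n\mathbb{E}\|\xi_n\|<\infty$, and let $(x_n)_{n\ge1}$ be the stochastic Mann sequence $x_{n+1}=(1-\frac{a}{n})x_n+\frac{a}{n}\left[F(x_n)+\frac1n\xi_n\right]$, started at $x_1\in\mathbb{B}$ with $\|x_1-x^*\|\le N$. Suppose that for some constants $\sigma$ and $L>0$ one has $\mathbb{E}\|\xi_i\|^m\le \frac{m!}{2}\sigma^2L^{m-2}$ for all $i\ge1$ and all integers $m\ge2$. Then for every level $\alpha>0$ and every $\varepsilon>0$ there is a natural integer $n_\alpha$ such that $x^*$ belongs to the closed ball of center $x_{n_\alpha+1}$ and radius $\varepsilon$ with probability at least $1-\alpha$, i.e. $$\forall\,\varepsilon>0,\ \forall\,\alpha>0,\ \exists\, n_\alpha\in\mathbb{N}:\quad \mathbb{P}\left\{\|x_{n_\alpha+1}-x^*\|\le\varepsilon\right\}\ge1-\alpha.$$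
   Context: $(\Omega,\mathcal{F},\mathbb{P})$ is a probability space carrying all random variables; $\mathbb{B}$ is equipped with its Borel $\sigma$-algebra. $F$ is a contraction with constant $c$ means $\|F(x)-F(y)\|\le c\|x-y\|$ for all $x,y\in\mathbb{B}$, with $c\in[0,1)$; by Banach's theorem $F$ has a unique fixed point $x^*$. *)

theory Defs
  imports "HOL-Probability.Probability"
begin

end

theory Submission
  imports Defs
begin

text \<open>Write \<open>u n\<close> for the expected error and \<open>b = a (1 - c)\<close>. The contraction property gives
  \<open>u (n+1) \<le> (1 - b/n) u n + a K/n^2\<close> with \<open>K = sup E \<parallel>\<xi>\<parallel>\<close>. If \<open>u n\<close> stayed above some positive
  constant, summing this inequality would make the harmonic series converge. Hence \<open>u n\<close> is
  arbitrarily small for some \<open>n\<close>, and Markov's inequality concludes.\<close>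

lemma perturbed_contraction_small_term:
  fixes u s t :: "nat \<Rightarrow> real"
  assumes nonneg: "\<And>n. 0 \<le> u n" "\<And>n. 0 \<le> s n" "\<And>n. 0 \<le> t n"
    and step: "\<And>n. u (Suc n) \<le> (1 - s n) * u n + t n"
    and divergent: "\<not> summable s" and "summable t" and "0 < \<delta>"
  shows "\<exists>n. u n < \<delta>"
proof (rule ccontr)
  assume "\<not> ?thesis"
  then have large: "\<delta> \<le> u n" for n
    by (simp add: not_less)
  \<comment> \<open>Telescoping: \<open>step\<close> rearranges to
    \<open>u n * s n \<le> u n - u (Suc n) + t n\<close>, and \<open>large\<close> allows
    \<open>\<delta>\<close> to replace the factor \<open>u n\<close> on the left.\<close>
  have partial: "(\<Sum>i<n. \<delta> * s i) \<le> u 0 - u n + (\<Sum>i<n. t i)" for n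
  proof (induction n)
    case (Suc n)
    have "\<delta> * s n \<le> u n * s n"
      using large nonneg by (intro mult_right_mono)
    then show ?case
      using Suc step[of n] by (simp add: algebra_simps)
  qed simp
  \<comment> \<open>The bound in \<open>partial\<close> becomes uniform in \<open>n\<close>: the
    term \<open>- u n\<close> is dropped, and the partial sums of \<open>t\<close> stay below
    \<open>suminf t\<close>.\<close>
  have "summable (\<lambda>n. \<delta> * s n)"
  proof (rule bounded_imp_summable)
    show "0 \<le> \<delta> * s n" for n
      using nonneg \<open>0 < \<delta>\<close> by simp
    show "(\<Sum>i\<le>n. \<delta> * s i) \<le> u 0 + suminf t" for n
      using partial[of "Suc n"] nonneg(1)[of "Suc n"]
        sum_le_suminf[OF \<open>summable t\<close>, of "{..n}"] nonneg(3)
      by (simp add: lessThan_Suc_atMost)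
  qed
  then show False
    using divergent \<open>0 < \<delta>\<close> by (simp add: summable_cmult_iff)
qed

text \<open>Since \<open>p = (1 - r) p + r F p\<close>, the error splits along the same convex
  combination as the iterate. The old error then carries the factor
  \<open>(1 - r) + r c = 1 - r (1 - c)\<close>.\<close>

lemma mann_step_error_bound:
  fixes F :: "'b::real_normed_vector \<Rightarrow> 'b"
  assumes "\<And>u v. norm (F u - F v) \<le> c * norm (u - v)" and "F p = p"
    and "0 \<le> r" "r \<le> 1"
  shows "norm ((1 - r) *\<^sub>R y + r *\<^sub>R (F y + z) - p)
    \<le> (1 - r * (1 - c)) * norm (y - p) + r * norm z"
proof -
  have "(1 - r) *\<^sub>R y + r *\<^sub>R (F y + z) - p = (1 - r) *\<^sub>R (y - p) + r *\<^sub>R (F y - F p) + r *\<^sub>R z"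
    using assms(2) by (simp add: algebra_simps)
  also have "norm \<dots> \<le> (1 - r) * norm (y - p) + r * norm (F y - F p) + r * norm z"
    using assms(3,4) by (intro norm_triangle_le add_mono) auto
  also have "\<dots> \<le> (1 - r) * norm (y - p) + r * (c * norm (y - p)) + r * norm z"
    using assms(1)[of y p] assms(3,4) by (intro add_mono mult_left_mono) auto
  finally show ?thesis
    by (simp add: algebra_simps)
qed

text \<open>Markov's inequality for the complementary event, which lies inside
  \<open>{\<epsilon> \<le> f}\<close>.\<close>

lemma (in prob_space) prob_le_ge_Markov:
  fixes f :: "'a \<Rightarrow> real"
  assumes [measurable]: "integrable M f" and "\<And>\<omega>. \<omega> \<in> space M \<Longrightarrow> 0 \<le> f \<omega>" and "0 < \<epsilon>"
  shows "1 - expectation f / \<epsilon> \<le> prob {\<omega> \<in> space M. f \<omega> \<le> \<epsilon>}"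
proof -
  have "prob {\<omega> \<in> space M. \<not> f \<omega> \<le> \<epsilon>} \<le> prob {\<omega> \<in> space M. \<epsilon> \<le> f \<omega>}"
    by (intro finite_measure_mono) auto
  also have "\<dots> \<le> expectation f / \<epsilon>"
    using assms by (intro integral_Markov_inequality_measure[where A = "{}"]) auto
  finally show ?thesis
    by (subst (asm) prob_neg) auto
qed

theorem corollary2:
  fixes M :: "'w measure"
    and F :: "'b::{banach, second_countable_topology} \<Rightarrow> 'b"
    and \<xi> :: "nat \<Rightarrow> 'w \<Rightarrow> 'b"
    and x :: "nat \<Rightarrow> 'w \<Rightarrow> 'b"
    and x\<^sub>1 xstar :: 'b
    and a c N \<sigma> L :: real
  assumes "prob_space M"
    and c: "0 \<le> c" "c < 1"
    and contraction: "\<And>u v. norm (F u - F v) \<le> c * norm (u - v)"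
    and fixed_point: "F xstar = xstar"
    and a: "0 < a" "a < 1"
    and indep: "prob_space.indep_vars M (\<lambda>_. borel) \<xi> {1..}"
    and zero_mean: "\<And>n. n \<ge> 1 \<Longrightarrow> integrable M (\<xi> n) \<and> integral\<^sup>L M (\<xi> n) = 0"
    and sup_moment: "(SUP n\<in>{1..}. \<integral>\<^sup>+ \<omega>. ennreal (norm (\<xi> n \<omega>)) \<partial>M) < \<infinity>"
    and start: "\<And>\<omega>. \<omega> \<in> space M \<Longrightarrow> x 1 \<omega> = x\<^sub>1"
    and start_bound: "norm (x\<^sub>1 - xstar) \<le> N"
    and mann: "\<And>n \<omega>. n \<ge> 1 \<Longrightarrow> \<omega> \<in> space M \<Longrightarrow>
        x (n + 1) \<omega> = (1 - a / real n) *\<^sub>R x n \<omega>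
          + (a / real n) *\<^sub>R (F (x n \<omega>) + (1 / real n) *\<^sub>R \<xi> n \<omega>)"
    and L: "L > 0"
    and moments: "\<And>i m. i \<ge> 1 \<Longrightarrow> m \<ge> 2 \<Longrightarrow>
        (\<integral>\<^sup>+ \<omega>. ennreal (norm (\<xi> i \<omega>) ^ m) \<partial>M)
          \<le> ennreal (fact m / 2 * \<sigma>\<^sup>2 * L ^ (m - 2))"
  shows "\<forall>\<epsilon>>0. \<forall>\<alpha>>0. \<exists>n\<^sub>\<alpha>::nat.
      measure M {\<omega> \<in> space M. norm (x (n\<^sub>\<alpha> + 1) \<omega> - xstar) \<le> \<epsilon>} \<ge> 1 - \<alpha>"
proof -
  interpret prob_space M by fact
  \<comment> \<open>\<open>enn2real\<close> sends infinity to 0, so \<open>K\<close> is the true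
    supremum only thanks to \<open>sup_moment\<close>.\<close>
  define K where "K = enn2real (SUP n\<in>{1..}. \<integral>\<^sup>+ \<omega>. ennreal (norm (\<xi> n \<omega>)) \<partial>M)"
  define b where "b = a * (1 - c)"
  \<comment> \<open>The index is shifted because the sequence starts at \<open>x 1\<close>:
    \<open>e 0\<close> is the deterministic initial error, and the step from \<open>e n\<close> to
    \<open>e (Suc n)\<close> has size \<open>a / Suc n\<close>.\<close>
  define e where "e n \<omega> = norm (x (Suc n) \<omega> - xstar)" for n \<omega>
  have K: "expectation (\<lambda>\<omega>. norm (\<xi> n \<omega>)) \<le> K" if "n \<ge> 1" for n
  proof -
    have "ennreal (expectation (\<lambda>\<omega>. norm (\<xi> n \<omega>))) = (\<integral>\<^sup>+ \<omega>. ennreal (norm (\<xi> n \<omega>)) \<partial>M)"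
      using zero_mean[OF that] by (intro nn_integral_eq_integral[symmetric]) auto
    also have "\<dots> \<le> (SUP n\<in>{1..}. \<integral>\<^sup>+ \<omega>. ennreal (norm (\<xi> n \<omega>)) \<partial>M)"
      using that by (intro SUP_upper) auto
    also have "\<dots> = ennreal K"
      using sup_moment by (simp add: K_def)
    finally show ?thesis
      by (simp add: K_def)
  qed
  have "0 \<le> K" by (simp add: K_def)
  have "0 < b" using a c by (simp add: b_def)
  have xi_measurable [measurable]: "\<xi> (Suc n) \<in> borel_measurable M" for n
    using zero_mean[of "Suc n"] by auto
  \<comment> \<open>Continuity makes \<open>F\<close> Borel, so that the iterates are random
    variables.\<close>
  have "c-lipschitz_on UNIV F"
    using c contraction by (intro lipschitz_onI) (auto simp: dist_norm)
  then have F_measurable [measurable]: "F \<in> borel_measurable borel"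
    by (intro borel_measurable_continuous_onI lipschitz_on_continuous_on)
  have x_Suc: "x (Suc (Suc n)) \<omega> = (1 - a / real (Suc n)) *\<^sub>R x (Suc n) \<omega>
      + (a / real (Suc n)) *\<^sub>R (F (x (Suc n) \<omega>) + (1 / real (Suc n)) *\<^sub>R \<xi> (Suc n) \<omega>)"
    if "\<omega> \<in> space M" for n \<omega>
    using mann[of "Suc n" \<omega>] that by simp
  \<comment> \<open>The start value and the recursion are known only on \<open>space M\<close>,
    hence the use of \<open>measurable_cong\<close>.\<close>
  have x_measurable [measurable]: "x (Suc n) \<in> borel_measurable M" for n
  proof (induction n)
    case 0
    have "x (Suc 0) \<in> borel_measurable M \<longleftrightarrow> (\<lambda>_. x\<^sub>1) \<in> borel_measurable M"
      using start by (intro measurable_cong) simp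
    then show ?case by simp
  next
    case (Suc n)
    note [measurable] = Suc
    show ?case
      by (subst measurable_cong[OF x_Suc]) measurable
  qed
  \<comment> \<open>Here \<open>r = a / Suc n\<close>, which is at most 1 because
    \<open>a < 1\<close>. The damping of the noise by \<open>1 / Suc n\<close> multiplies with this
    \<open>r\<close> to give the square in the denominator.\<close>
  have e_Suc: "e (Suc n) \<omega> \<le> (1 - b / real (Suc n)) * e n \<omega>
      + a / real (Suc n) ^ 2 * norm (\<xi> (Suc n) \<omega>)" if "\<omega> \<in> space M" for n \<omega>
    using mann_step_error_bound[OF contraction fixed_point, of "a / real (Suc n)" "x (Suc n) \<omega>"
        "(1 / real (Suc n)) *\<^sub>R \<xi> (Suc n) \<omega>"] a
    unfolding e_def x_Suc[OF that] by (simp add: b_def power2_eq_square)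
  have xi_integrable: "integrable M (\<lambda>\<omega>. norm (\<xi> (Suc n) \<omega>))" for n
    using zero_mean[of "Suc n"] by auto
  have e_integrable: "integrable M (e n)" for n
  proof (induction n)
    case 0
    have "integrable M (e 0) \<longleftrightarrow> integrable M (\<lambda>_. norm (x\<^sub>1 - xstar))"
      using start by (intro Bochner_Integration.integrable_cong) (auto simp: e_def)
    then show ?case by simp
  next
    case (Suc n)
    show ?case
    \<comment> \<open>The pointwise recursion itself supplies the integrable majorant.\<close>
    proof (rule Bochner_Integration.integrable_bound)
      show "integrable M (\<lambda>\<omega>. (1 - b / real (Suc n)) * e n \<omega>
          + a / real (Suc n) ^ 2 * norm (\<xi> (Suc n) \<omega>))"
        using Suc xi_integrable by (intro Bochner_Integration.integrable_add integrable_mult_right)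
      show "e (Suc n) \<in> borel_measurable M"
        unfolding e_def by measurable
      show "AE \<omega> in M. norm (e (Suc n) \<omega>) \<le> norm ((1 - b / real (Suc n)) * e n \<omega>
          + a / real (Suc n) ^ 2 * norm (\<xi> (Suc n) \<omega>))"
      proof (rule AE_I2)
        fix \<omega> assume "\<omega> \<in> space M"
        moreover have "0 \<le> e (Suc n) \<omega>" by (simp add: e_def)
        ultimately show "norm (e (Suc n) \<omega>) \<le> norm ((1 - b / real (Suc n)) * e n \<omega>
            + a / real (Suc n) ^ 2 * norm (\<xi> (Suc n) \<omega>))"
          using e_Suc[of \<omega> n] unfolding real_norm_def by linarith
      qed
    qed
  qed
  have step: "expectation (e (Suc n)) \<le> (1 - b / real (Suc n)) * expectation (e n)
      + a * K / real (Suc n) ^ 2" for n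
  proof -
    have "expectation (e (Suc n)) \<le> expectation (\<lambda>\<omega>. (1 - b / real (Suc n)) * e n \<omega>
        + a / real (Suc n) ^ 2 * norm (\<xi> (Suc n) \<omega>))"
      using e_integrable xi_integrable e_Suc
      by (intro integral_mono Bochner_Integration.integrable_add integrable_mult_right)
    also have "\<dots> = (1 - b / real (Suc n)) * expectation (e n)
        + a / real (Suc n) ^ 2 * expectation (\<lambda>\<omega>. norm (\<xi> (Suc n) \<omega>))"
      using e_integrable xi_integrable
      by (subst Bochner_Integration.integral_add) (simp_all del: of_nat_Suc)
    also have "\<dots> \<le> (1 - b / real (Suc n)) * expectation (e n) + a / real (Suc n) ^ 2 * K"
      using K[of "Suc n"] a by (intro add_left_mono mult_left_mono) auto
    finally show ?thesis by simp
  qed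
  \<comment> \<open>This is the harmonic series, scaled by \<open>b > 0\<close> and shifted by one
    index.\<close>
  have divergent: "\<not> summable (\<lambda>n. b / real (Suc n))"
  proof
    assume "summable (\<lambda>n. b / real (Suc n))"
    then have "summable (\<lambda>n. b * (1 / real (Suc n)))" by simp
    then have "summable (\<lambda>n. 1 / real (Suc n))"
      using \<open>0 < b\<close> by (subst (asm) summable_cmult_iff) simp
    then have "summable (\<lambda>n. 1 / real n)"
      by (subst (asm) summable_Suc_iff)
    then show False
      using not_summable_harmonic[where 'a = real] by (simp add: inverse_eq_divide)
  qed
  have "summable (\<lambda>n. inverse (real (Suc n) ^ 2))"
    using inverse_power_summable[of 2, where 'a = real] by (subst summable_Suc_iff) auto
  then have "summable (\<lambda>n. a * K * inverse (real (Suc n) ^ 2))"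
    by (rule summable_mult)
  then have convergent: "summable (\<lambda>n. a * K / real (Suc n) ^ 2)"
    by (simp only: divide_inverse)
  show ?thesis
  proof (intro allI impI)
    fix \<epsilon> \<alpha> :: real assume pos: "0 < \<epsilon>" "0 < \<alpha>"
    \<comment> \<open>The threshold \<open>\<epsilon> * \<alpha>\<close> is chosen so that the
      Markov quotient \<open>expectation (e n) / \<epsilon>\<close> falls below
      \<open>\<alpha>\<close>. As \<open>e n\<close> measures the error of \<open>x (n + 1)\<close>,
      this \<open>n\<close> is itself the witness.\<close>
    obtain n where n: "expectation (e n) < \<epsilon> * \<alpha>"
      using perturbed_contraction_small_term[OF _ _ _ step divergent convergent, of "\<epsilon> * \<alpha>"]
        pos a \<open>0 < b\<close> \<open>0 \<le> K\<close> by (auto simp: e_def)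
    have "1 - \<alpha> \<le> 1 - expectation (e n) / \<epsilon>"
      using n pos by (simp add: field_simps)
    also have "\<dots> \<le> prob {\<omega> \<in> space M. e n \<omega> \<le> \<epsilon>}"
      using e_integrable pos by (intro prob_le_ge_Markov) (auto simp: e_def)
    finally show "\<exists>n. 1 - \<alpha> \<le> prob {\<omega> \<in> space M. norm (x (n + 1) \<omega> - xstar) \<le> \<epsilon>}"
      by (auto simp: e_def)
  qed
qed

end
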